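(* Let $P(g\mid O_s,O_e)$ be a (positive, differentiable in $g$) probability density function on $SE(3)$ conditioned on point clouds $O_s,O_e\in\mathcal{O}$, and let $s(g\mid O_s,O_e)=\nabla\log P(g\mid O_s,O_e)\in\mathfrak{se}(3)\cong\mathbb{R}^6$ be its score function. If $P$ is bi-equivariant, then for all $\Delta g\in SE(3)$, all $g\in SE(3)$ and all $O_s,O_e\in\mathcal{O}$, $$s(\Delta g\,g\mid \Delta g\cdot O_s,O_e)=s(g\mid O_s,O_e),$$ $$s(g\,\Delta g^{-1}\mid O_s,\Delta g\cdot O_e)=\left[\mathrm{Ad}_{\Delta g}\right]^{-T}s(g\mid O_s,O_e).$$
   Context: $\mathcal{O}$ is the set of point clouds in $\mathbb{R}^3$, on which $SE(3)$ acts from the left by rigid motion of the points, written $\Delta g\cdot O$. Elements of $SE(3)$ are written $g=(p,R)$ with $p\in\mathbb{R}^3$, $R\in SO(3)$. Probability density functions on $SE(3)$ are taken with respect to the bi-invariant (Haar) volume $dg$. Bi-equivariance of $P$ means that for all $\Delta g,g\in SE(3)$ and $O_s,O_e\in\mathcal{O}$, $$P(g\mid O_s,O_e)=P(\Delta g\,g\mid\Delta g\cdot O_s,O_e)=P(g\,\Delta g^{-1}\mid O_s,\Delta g\cdot O_e).$$ For $\mathcal{V}\in\mathfrak{se}(3)$ and a differentiable function $f$ on $SE(3)$, the Lie derivative is $\mathcal{L}_{\mathcal{V}}f(g)=\left.\frac{d}{d\epsilon}\right|_{\epsilon=0}f(g\exp[\epsilon\mathcal{V}])$. Let $\hat e_1,\dots,\hat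 e_6$ be the standard basis of $\mathfrak{se}(3)\cong\mathbb{R}^6$, with the three translational basis elements first and the three rotational ones last. The gradient is $\nabla f(g)=\sum_{i=1}^6(\mathcal{L}_{\hat e_i}f)(g)\,\hat e_i$, identified with a column vector in $\mathbb{R}^6$; in the score the derivative acts on $g\mapsto \log P(g\mid O_s,O_e)$, evaluated at the indicated argument. The adjoint representation in this basis is, for $g=(p,R)$, $$\mathrm{Ad}_g=\begin{bmatrix}R&[p]^{\wedge}R\\0&R\end{bmatrix},$$ where $[p]^{\wedge}$ is the $3\times3$ skew-symmetric matrix with $[p]^{\wedge}x=p\times x$. $A^{-T}$ denotes the inverse transpose of $A$. *)

theory Defs
  imports "HOL-Analysis.Analysis"
begin

type_synonym rigid = "(real^3) \<times> (real^3^3)"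

(* Coordinates of se(3): Inl indexes the translational basis elements, Inr the rotational ones. *)
type_synonym twist = "real^(3 + 3)"

type_synonym cloud = "(real^3) set"

definition SE3 :: "rigid set" where
  "SE3 = {(p, R). rotation_matrix R}"

definition se3_mult :: "rigid \<Rightarrow> rigid \<Rightarrow> rigid"  (infixl "\<odot>" 70) where
  "g \<odot> h = (fst g + snd g *v fst h, snd g ** snd h)"

definition se3_one :: rigid where
  "se3_one = (0, mat 1)"

definition se3_inv :: "rigid \<Rightarrow> rigid" where
  "se3_inv g = (- (transpose (snd g) *v fst g), transpose (snd g))"

lemma rotation_matrix_mult:
  fixes A B :: "real^'n^'n"
  assumes "rotation_matrix A" "rotation_matrix B"
  shows "rotation_matrix (A ** B)"
  using assms by (simp add: rotation_matrix_def orthogonal_matrix_mul det_mul)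

lemma se3_one_in [simp]: "se3_one \<in> SE3"
  by (simp add: SE3_def se3_one_def rotation_matrix_def orthogonal_matrix_id)

lemma se3_mult_in [simp]: "g \<in> SE3 \<Longrightarrow> h \<in> SE3 \<Longrightarrow> g \<odot> h \<in> SE3"
  by (auto simp: SE3_def se3_mult_def rotation_matrix_mult)

lemma se3_inv_in [simp]: "g \<in> SE3 \<Longrightarrow> se3_inv g \<in> SE3"
  by (auto simp: SE3_def se3_inv_def rotation_matrix_def orthogonal_matrix_transpose)

lemma se3_mult_assoc: "(g \<odot> h) \<odot> k = g \<odot> (h \<odot> k)"
  by (simp add: se3_mult_def matrix_vector_right_distrib matrix_vector_mul_assoc
      matrix_mul_assoc add.assoc)

lemma se3_one_mult [simp]: "se3_one \<odot> g = g" "g \<odot> se3_one = g"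
  by (simp_all add: se3_mult_def se3_one_def)

lemma se3_inv_mult [simp]:
  assumes "g \<in> SE3"
  shows "se3_inv g \<odot> g = se3_one" "g \<odot> se3_inv g = se3_one"
  using assms
  by (auto simp: SE3_def se3_mult_def se3_one_def se3_inv_def rotation_matrix_def
      orthogonal_matrix_def matrix_vector_mul_assoc vec.neg
      simp del: transpose_matrix_vector)

definition se3_apply :: "rigid \<Rightarrow> real^3 \<Rightarrow> real^3" where
  "se3_apply g x = fst g + snd g *v x"

(* The empty cloud is excluded: it is fixed by all of SE(3), so a bi-equivariant function is
   constant in g when conditioned on it, and a constant is not a probability density on the
   noncompact group SE(3). *)
definition point_clouds :: "cloud set" where
  "point_clouds = {X. finite X \<and> X \<noteq> {}}"

definition cloud_act :: "rigid \<Rightarrow> cloud \<Rightarrow> cloud"  (infixr "\<cdot>" 75) where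
  "g \<cdot> X = se3_apply g ` X"

(* HOL-Analysis has no multiplicative structure on matrices that the constant exp could use:
   the operation * on vectors is componentwise. *)
definition matrix_exp :: "real^'n^'n \<Rightarrow> real^'n^'n" where
  "matrix_exp A = (\<Sum>n. (1 / fact n) *\<^sub>R ((\<lambda>B. A ** B) ^^ n) (mat 1))"

definition skew :: "real^3 \<Rightarrow> real^3^3" where
  "skew p = matrix (cross3 p)"

lemma skew_mult: "skew p *v x = cross3 p x"
  using bilinear_cross matrix_works[of "cross3 p"]
  by (simp add: skew_def bilinear_def linear_matrix_vector_mul_eq)

(* The homogeneous 4 x 4 matrix with blocks [w]^ and v in the upper row and 0, 0 in the lower
   row, where v, w are the translational and rotational parts of V. *)
definition se3_hat :: "twist \<Rightarrow> real^(3 + 1)^(3 + 1)" where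
  "se3_hat V = (\<chi> i j. case (i, j) of
       (Inl a, Inl b) \<Rightarrow> skew (\<chi> k. V $ Inr k) $ a $ b
     | (Inl a, Inr _) \<Rightarrow> V $ Inl a
     | (Inr _, _) \<Rightarrow> 0)"

(* Reads (p, R) off the homogeneous matrix with upper row R, p. *)
definition of_homogeneous :: "real^(3 + 1)^(3 + 1) \<Rightarrow> rigid" where
  "of_homogeneous M = ((\<chi> a. M $ Inl a $ Inr 1), (\<chi> a b. M $ Inl a $ Inl b))"

definition se3_exp :: "twist \<Rightarrow> rigid" where
  "se3_exp V = of_homogeneous (matrix_exp (se3_hat V))"

definition Ad :: "rigid \<Rightarrow> real^(3 + 3)^(3 + 3)" where
  "Ad g = (\<chi> i j. case (i, j) of
       (Inl a, Inl b) \<Rightarrow> snd g $ a $ b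
     | (Inl a, Inr b) \<Rightarrow> (skew (fst g) ** snd g) $ a $ b
     | (Inr a, Inl b) \<Rightarrow> 0
     | (Inr a, Inr b) \<Rightarrow> snd g $ a $ b)"

definition lie_deriv :: "twist \<Rightarrow> (rigid \<Rightarrow> real) \<Rightarrow> rigid \<Rightarrow> real" where
  "lie_deriv V f g = deriv (\<lambda>\<epsilon>. f (g \<odot> se3_exp (\<epsilon> *\<^sub>R V))) 0"

definition se3_grad :: "(rigid \<Rightarrow> real) \<Rightarrow> rigid \<Rightarrow> twist" where
  "se3_grad f g = (\<Sum>i\<in>UNIV. lie_deriv (axis i 1) f g *\<^sub>R axis i 1)"

(* Determines the bi-invariant Radon measure on SE(3) up to a positive factor. *)
definition bi_invariant_haar :: "rigid measure \<Rightarrow> bool" where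
  "bi_invariant_haar \<mu> \<longleftrightarrow>
     sets \<mu> = sets (restrict_space borel SE3) \<and>
     (\<forall>K. compact K \<and> K \<subseteq> SE3 \<longrightarrow> emeasure \<mu> K < \<infinity>) \<and>
     emeasure \<mu> SE3 \<noteq> 0 \<and>
     (\<forall>h\<in>SE3. distr \<mu> \<mu> (\<lambda>g. h \<odot> g) = \<mu> \<and> distr \<mu> \<mu> (\<lambda>g. g \<odot> h) = \<mu>)"

definition prob_density :: "rigid measure \<Rightarrow> (rigid \<Rightarrow> real) \<Rightarrow> bool" where
  "prob_density \<mu> f \<longleftrightarrow>
     f \<in> borel_measurable \<mu> \<and> (\<forall>g\<in>SE3. 0 \<le> f g) \<and> (\<integral>\<^sup>+ g. ennreal (f g) \<partial>\<mu>) = 1"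

definition bi_equivariant :: "(rigid \<Rightarrow> cloud \<Rightarrow> cloud \<Rightarrow> real) \<Rightarrow> bool" where
  "bi_equivariant P \<longleftrightarrow>
     (\<forall>h\<in>SE3. \<forall>g\<in>SE3. \<forall>Os\<in>point_clouds. \<forall>Oe\<in>point_clouds.
        P g Os Oe = P (h \<odot> g) (h \<cdot> Os) Oe \<and>
        P g Os Oe = P (g \<odot> se3_inv h) Os (h \<cdot> Oe))"

definition score :: "(rigid \<Rightarrow> cloud \<Rightarrow> cloud \<Rightarrow> real) \<Rightarrow> rigid \<Rightarrow> cloud \<Rightarrow> cloud \<Rightarrow> twist" where
  "score P g Os Oe = se3_grad (\<lambda>x. ln (P x Os Oe)) g"

end

theory Submission
  imports Defs
begin

text \<open>Bi-equivariance turns the function of \<open>\<epsilon>\<close> whose derivative is the \<open>i\<close>-th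
  component of the transformed score into
  \<open>log P(g exp(\<epsilon> e\<^sub>i) | O\<^sub>s, O\<^sub>e)\<close> for left translation and into
  \<open>log P(g \<Delta>g\<^sup>-\<^sup>1 exp(\<epsilon> e\<^sub>i) \<Delta>g | O\<^sub>s, O\<^sub>e)\<close> for right translation.
  The first gives invariance at once. In the second, the curve leaves \<open>g\<close> with body velocity
  \<open>Ad\<^bsub>\<Delta>g\<^esub>\<^sup>-\<^sup>1 e\<^sub>i\<close>, and the Lie derivative is linear in the velocity, being the inner product
  with the gradient; moving the adjoint to the other side gives the inverse transpose.
  Differentiability is assumed only within SE(3), so the chain rule needs the exponential
  curve to stay in SE(3); this follows from the linear differential equation that it solves.\<close>

section \<open>Block sums, componentwise derivatives and matrix inverses\<close>

lemma sum_UNIV_sum: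
  fixes f :: "'a::finite + 'b::finite \<Rightarrow> 'c::comm_monoid_add"
  shows "(\<Sum>i\<in>UNIV. f i) = (\<Sum>i\<in>UNIV. f (Inl i)) + (\<Sum>i\<in>UNIV. f (Inr i))"
  by (subst UNIV_Plus_UNIV[symmetric], subst sum.Plus) (simp_all add: o_def)

lemma has_vector_derivative_vecI:
  fixes f :: "real \<Rightarrow> 'a::real_normed_vector^'n"
  assumes "\<And>i. ((\<lambda>t. f t $ i) has_vector_derivative f' $ i) (at t within S)"
  shows "(f has_vector_derivative f') (at t within S)"
  unfolding has_vector_derivative_def has_derivative_within
proof (intro conjI vec_tendstoI)
  show "bounded_linear (\<lambda>x. x *\<^sub>R f')"
    by (rule bounded_linear_scaleR_left)
  show "((\<lambda>y. ((1 / norm (y - t)) *\<^sub>R (f y - (f t + (y - t) *\<^sub>R f'))) $ i) \<longlongrightarrow> 0 $ i)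
          (at t within S)" for i
    using assms[of i] by (simp add: has_vector_derivative_def has_derivative_within)
qed

lemma has_vector_derivative_vec_nth:
  "(f has_vector_derivative f') F \<Longrightarrow> ((\<lambda>t. f t $ i) has_vector_derivative f' $ i) F"
  by (rule bounded_linear.has_vector_derivative[OF bounded_linear_vec_nth])

lemma matrix_add_rdistrib: "(A + B) ** C = A ** C + B ** C"
  by (simp add: matrix_matrix_mult_def vec_eq_iff sum.distrib distrib_right)

text \<open>\<open>matrix_inv\<close> is a choice among two-sided inverses. A left inverse of a
  square matrix is also a right inverse, so the choice has a witness, and uniqueness of inverses
  identifies it with \<open>B\<close>.\<close>

lemma matrix_inv_eqI:
  fixes A B :: "'a::field^'n^'n"
  assumes "B ** A = mat 1"
  shows "matrix_inv A = B"
proof -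
  have "A ** B = mat 1"
    using assms by (simp add: matrix_left_right_inverse)
  then have "A ** matrix_inv A = mat 1 \<and> matrix_inv A ** A = mat 1"
    unfolding matrix_inv_def using assms
    by (intro someI[of "\<lambda>A'. A ** A' = mat 1 \<and> A' ** A = mat 1" B]) simp
  then have "B ** A ** matrix_inv A = B"
    by (metis matrix_mul_assoc matrix_mul_rid)
  then show ?thesis
    using assms by simp
qed

section \<open>The matrix exponential\<close>

abbreviation mpow :: "real^'n^'n \<Rightarrow> nat \<Rightarrow> real^'n^'n" where
  "mpow A n \<equiv> ((\<lambda>B. A ** B) ^^ n) (mat 1)"

lemma mpow_scaleR: "mpow (t *\<^sub>R A) n = t ^ n *\<^sub>R mpow A n"
  by (induction n) (simp_all add: matrix_scalar_ac flip: scalar_matrix_assoc)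

text \<open>An entry of a product is a sum of \<open>CARD('n)\<close> terms, so each further factor
  \<open>A\<close> costs at most \<open>CARD('n) * c\<close>. The growth is geometric in
  \<open>n\<close>, which the factorial in the exponential series dominates.\<close>

lemma mpow_entry_bound:
  fixes A :: "real^'n^'n"
  assumes "\<And>i j. \<bar>A $ i $ j\<bar> \<le> c"
  shows "\<bar>mpow A n $ i $ j\<bar> \<le> (real CARD('n) * c) ^ n"
proof (induction n arbitrary: i j)
  case 0
  then show ?case by (simp add: mat_def)
next
  case (Suc n)
  have "\<bar>\<Sum>k\<in>UNIV. A $ i $ k * mpow A n $ k $ j\<bar>
      \<le> (\<Sum>k\<in>(UNIV::'n set). c * (real CARD('n) * c) ^ n)"
  proof (rule order_trans[OF sum_abs sum_mono])
    fix k
    show "\<bar>A $ i $ k * mpow A n $ k $ j\<bar> \<le> c * (real CARD('n) * c) ^ n"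
      using assms[of i k] Suc.IH[of k j] by (auto simp: abs_mult intro!: mult_mono)
  qed
  then show ?case
    by (simp add: matrix_matrix_mult_def algebra_simps)
qed

lemma summable_mpow_entry:
  fixes A :: "real^'n^'n"
  shows "summable (\<lambda>n. mpow A n $ i $ j / fact n * t ^ n)"
proof -
  define c where "c = (\<Sum>i\<in>UNIV. \<Sum>j\<in>UNIV. \<bar>A $ i $ j\<bar>)"
  have c: "\<bar>A $ i $ j\<bar> \<le> c" for i j
  proof -
    have "\<bar>A $ i $ j\<bar> \<le> (\<Sum>j\<in>UNIV. \<bar>A $ i $ j\<bar>)"
      by (rule member_le_sum) auto
    also have "\<dots> \<le> c"
      unfolding c_def
      by (rule member_le_sum[where f = "\<lambda>i. \<Sum>j\<in>UNIV. \<bar>A $ i $ j\<bar>"]) (auto intro: sum_nonneg)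
    finally show ?thesis .
  qed
  show ?thesis
  proof (rule summable_comparison_test'[where N = 0])
    show "summable (\<lambda>n. inverse (fact n) * (real CARD('n) * c * \<bar>t\<bar>) ^ n)"
      by (rule summable_exp)
    show "norm (mpow A n $ i $ j / fact n * t ^ n)
        \<le> inverse (fact n) * (real CARD('n) * c * \<bar>t\<bar>) ^ n" for n
      using mult_right_mono[OF mpow_entry_bound[OF c, of n i j], of "\<bar>t\<bar> ^ n / fact n"]
      by (simp add: abs_mult power_abs power_mult_distrib divide_simps mult_ac)
  qed
qed

text \<open>Convergence of matrices is entrywise. Each entry of the exponential thus becomes a real
  power series in \<open>t\<close>, to which termwise differentiation applies.\<close>

lemma matrix_exp_entry:
  fixes A :: "real^'n^'n"
  shows "matrix_exp (t *\<^sub>R A) $ i $ j = (\<Sum>n. mpow A n $ i $ j / fact n * t ^ n)"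
proof -
  have "(\<lambda>n. (1 / fact n) *\<^sub>R mpow (t *\<^sub>R A) n) sums
      (\<chi> i j. \<Sum>n. mpow A n $ i $ j / fact n * t ^ n)"
    unfolding sums_def
  proof (intro vec_tendstoI)
    fix i j
    show "(\<lambda>N. (\<Sum>n<N. (1 / fact n) *\<^sub>R mpow (t *\<^sub>R A) n) $ i $ j)
        \<longlonglongrightarrow> (\<chi> i j. \<Sum>n. mpow A n $ i $ j / fact n * t ^ n) $ i $ j"
      using summable_LIMSEQ[OF summable_mpow_entry[of A i j t]]
      by (simp add: mpow_scaleR mult_ac)
  qed
  then show ?thesis
    by (simp add: matrix_exp_def sums_iff)
qed

lemma matrix_exp_0: "matrix_exp (0 :: real^'n^'n) = mat 1"
  using trans[OF matrix_exp_entry powser_zero, of "0 :: real^'n^'n"] by (simp add: vec_eq_iff)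

lemma matrix_exp_has_vector_derivative:
  fixes A :: "real^'n^'n"
  shows "((\<lambda>t. matrix_exp (t *\<^sub>R A)) has_vector_derivative A ** matrix_exp (t *\<^sub>R A)) (at t)"
proof (intro has_vector_derivative_vecI)
  fix i j
  \<comment> \<open>The factor n + 1 from differentiating the power n + 1 of \<open>t\<close>
    cancels against \<open>fact (Suc n)\<close> and leaves one extra factor
    \<open>A\<close>.\<close>
  have "diffs (\<lambda>n. mpow A n $ i $ j / fact n) n = (A ** mpow A n) $ i $ j / fact n" for n
    by (simp add: diffs_def divide_simps del: of_nat_Suc)
  then have "(\<Sum>n. diffs (\<lambda>n. mpow A n $ i $ j / fact n) n * t ^ n)
      = (\<Sum>n. \<Sum>k\<in>UNIV. A $ i $ k * (mpow A n $ k $ j / fact n * t ^ n))"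
    by (simp add: matrix_matrix_mult_def sum_distrib_right sum_divide_distrib mult.assoc)
  also have "\<dots> = (\<Sum>k\<in>UNIV. \<Sum>n. A $ i $ k * (mpow A n $ k $ j / fact n * t ^ n))"
    by (rule suminf_sum) (intro summable_mult summable_mpow_entry)
  also have "\<dots> = (A ** matrix_exp (t *\<^sub>R A)) $ i $ j"
    by (simp only: suminf_mult[OF summable_mpow_entry])
      (simp add: matrix_matrix_mult_def matrix_exp_entry)
  finally show "((\<lambda>t. matrix_exp (t *\<^sub>R A) $ i $ j) has_vector_derivative
      (A ** matrix_exp (t *\<^sub>R A)) $ i $ j) (at t)"
    using termdiffs_strong_converges_everywhere[OF summable_mpow_entry, of A i j t]
    by (simp add: matrix_exp_entry flip: has_real_derivative_iff_has_vector_derivative)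
qed

section \<open>The exponential curve in SE(3)\<close>

abbreviation trans_part :: "twist \<Rightarrow> real^3" where
  "trans_part V \<equiv> \<chi> k. V $ Inl k"

abbreviation rot_part :: "twist \<Rightarrow> real^3" where
  "rot_part V \<equiv> \<chi> k. V $ Inr k"

lemma skew_entries:
  "skew w $ 1 $ 1 = 0" "skew w $ 1 $ 2 = - w $ 3" "skew w $ 1 $ 3 = w $ 2"
  "skew w $ 2 $ 1 = w $ 3" "skew w $ 2 $ 2 = 0" "skew w $ 2 $ 3 = - w $ 1"
  "skew w $ 3 $ 1 = - w $ 2" "skew w $ 3 $ 2 = w $ 1" "skew w $ 3 $ 3 = 0"
  by (simp_all add: skew_def matrix_def cross_components axis_def)

lemma se3_hat_scaleR: "se3_hat (t *\<^sub>R V) = t *\<^sub>R se3_hat V"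
proof -
  have "skew (\<chi> k. t * w $ k) $ a $ b = t * skew w $ a $ b" for w a b
    using exhaust_3[of a] exhaust_3[of b] by (auto simp: skew_entries)
  from this[of "rot_part V"] show ?thesis
    by (auto simp: se3_hat_def vec_eq_iff split: sum.splits)
qed

lemma se3_exp_0: "se3_exp 0 = se3_one"
proof -
  have "matrix_exp (se3_hat 0) = mat 1"
    using se3_hat_scaleR[of 0 0] matrix_exp_0 by simp
  then show ?thesis
    by (simp add: se3_exp_def of_homogeneous_def se3_one_def mat_def vec_eq_iff)
qed

text \<open>The lower row of \<open>se3_hat V\<close> is zero, so the differential equation of the
  exponential keeps the lower row at its value at time 0.\<close>

lemma exp_hat_bottom_row:
  "matrix_exp (t *\<^sub>R se3_hat V) $ Inr i $ j = mat 1 $ Inr i $ j"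
proof -
  have "DERIV (\<lambda>t. matrix_exp (t *\<^sub>R se3_hat V) $ Inr i $ j) t :> 0" for t
    using has_vector_derivative_vec_nth[OF has_vector_derivative_vec_nth[OF
        matrix_exp_has_vector_derivative[of "se3_hat V" t]], of "Inr i" j]
    by (simp add: has_real_derivative_iff_has_vector_derivative matrix_matrix_mult_def se3_hat_def)
  then show ?thesis
    using DERIV_isconst_all[of "\<lambda>t. matrix_exp (t *\<^sub>R se3_hat V) $ Inr i $ j" t 0]
    by (simp add: matrix_exp_0)
qed

text \<open>This is M' = \<open>se3_hat V\<close> M read in blocks: p' = v + [w]^ p and R' = [w]^ R.
  The constant lower row 0, 1 of M produces the inhomogeneous term v.\<close>

lemma se3_exp_has_vector_derivative:
  "((\<lambda>t. se3_exp (t *\<^sub>R V)) has_vector_derivative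
     (trans_part V + skew (rot_part V) *v fst (se3_exp (t *\<^sub>R V)),
      skew (rot_part V) ** snd (se3_exp (t *\<^sub>R V)))) (at t)"
proof -
  let ?M = "\<lambda>t. matrix_exp (t *\<^sub>R se3_hat V)"
  have entry: "((\<lambda>t. ?M t $ i $ j) has_vector_derivative (se3_hat V ** ?M t) $ i $ j) (at t)"
    for i j
    by (intro has_vector_derivative_vec_nth matrix_exp_has_vector_derivative)
  have upper_right: "(se3_hat V ** ?M t) $ Inl a $ Inr 1
      = (trans_part V + skew (rot_part V) *v (\<chi> a. ?M t $ Inl a $ Inr 1)) $ a" for a
    by (simp add: matrix_matrix_mult_def matrix_vector_mult_def sum_UNIV_sum
        exp_hat_bottom_row) (simp add: se3_hat_def mat_def)
  have upper_left: "(se3_hat V ** ?M t) $ Inl a $ Inl b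
      = (skew (rot_part V) ** (\<chi> a b. ?M t $ Inl a $ Inl b)) $ a $ b" for a b
    by (simp add: matrix_matrix_mult_def sum_UNIV_sum
        exp_hat_bottom_row) (simp add: se3_hat_def mat_def)
  show ?thesis
    unfolding se3_exp_def of_homogeneous_def se3_hat_scaleR fst_conv snd_conv
    by (intro has_vector_derivative_Pair has_vector_derivative_vecI)
      (use entry[of "Inl _" "Inr 1", unfolded upper_right] entry[of "Inl _" "Inl _", unfolded upper_left]
        in \<open>simp_all only: vec_lambda_beta\<close>)
qed

text \<open>The rotational block starts at the identity and stays orthogonal. Its determinant is
  continuous in time and is always 1 or -1, so it cannot pass from 1 to -1 without vanishing in
  between.\<close>

lemma se3_exp_in: "se3_exp V \<in> SE3"
proof -
  define w where "w = rot_part V"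
  define R where "R = (\<lambda>t. snd (se3_exp (t *\<^sub>R V)))"
  have deriv: "((\<lambda>t. R t $ a $ b) has_real_derivative (skew w ** R t) $ a $ b) (at t)" for a b t
    unfolding has_real_derivative_iff_has_vector_derivative R_def w_def
    by (intro has_vector_derivative_vec_nth)
      (use bounded_linear.has_vector_derivative[OF bounded_linear_snd
          se3_exp_has_vector_derivative[of V t]] in simp)
  have R0: "R 0 = mat 1"
    by (simp add: R_def se3_exp_0 se3_one_def)
  have orth: "transpose (R t) ** R t = mat 1" for t
  proof -
    have "(transpose (R t) ** R t) $ a $ b = (mat 1 :: real^3^3) $ a $ b" for a b
    proof -
      \<comment> \<open>Since R' = [w]^ R, the derivative of the Gram matrix is R^T ([w]^T + [w]) R,
        which vanishes because \<open>skew w\<close> is skew-symmetric.\<close>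
      have "DERIV (\<lambda>t. \<Sum>c\<in>UNIV. R t $ c $ a * R t $ c $ b) t :> 0" for t
        by (rule derivative_eq_intros deriv refl)+
          (simp add: matrix_matrix_mult_def sum_3 skew_entries algebra_simps)
      moreover have "(\<Sum>c\<in>UNIV. R t $ c $ a * R t $ c $ b) = (transpose (R t) ** R t) $ a $ b" for t
        by (simp add: matrix_matrix_mult_def transpose_def)
      ultimately have "(transpose (R t) ** R t) $ a $ b = (transpose (R 0) ** R 0) $ a $ b"
        using DERIV_isconst_all[of "\<lambda>t. \<Sum>c\<in>UNIV. R t $ c $ a * R t $ c $ b" t 0] by simp
      then show ?thesis
        by (simp add: R0)
    qed
    then show ?thesis
      by (simp add: vec_eq_iff)
  qed
  then have ortho: "orthogonal_matrix (R t)" for t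
    by (simp add: orthogonal_matrix)
  have "continuous_on {0..1} (\<lambda>t. R t $ a $ b)" for a b
    by (rule DERIV_continuous_on, rule has_field_derivative_at_within, rule deriv)
  then have cont: "continuous_on {0..1} (\<lambda>t. det (R t))"
    unfolding det_3 by (intro continuous_on_add continuous_on_diff continuous_on_mult)
  have "det (R 1) = 1"
  proof (rule ccontr)
    assume "det (R 1) \<noteq> 1"
    then have "det (R 1) = - 1"
      using det_orthogonal_matrix[OF ortho] by blast
    then obtain t where "det (R t) = 0"
      using IVT2'[of "\<lambda>t. det (R t)" 1 0 0] cont by (auto simp: R0)
    then show False
      using det_orthogonal_matrix[OF ortho, of t] by simp
  qed
  with ortho[of 1] show ?thesis
    by (auto simp: SE3_def rotation_matrix_def R_def split_beta)
qed

section \<open>Lie derivatives along curves\<close>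

lemma se3_mult_left_has_vector_derivative:
  assumes "(\<gamma> has_vector_derivative u) F"
  shows "((\<lambda>t. g \<odot> \<gamma> t) has_vector_derivative (snd g *v fst u, snd g ** snd u)) F"
proof -
  have "linear (\<lambda>u::rigid. (snd g *v fst u, snd g ** snd u))"
    by (intro linearI)
      (simp_all add: matrix_vector_right_distrib matrix_add_ldistrib matrix_scalar_ac
        matrix_vector_mult_scaleR flip: scalar_matrix_assoc)
  then have "bounded_linear (\<lambda>u::rigid. (snd g *v fst u, snd g ** snd u))"
    by (simp add: linear_conv_bounded_linear)
  \<comment> \<open>Left multiplication is only affine in the ambient vector space; the constant
    \<open>(fst g, 0)\<close> is split off and differentiates to 0.\<close>
  then have "((\<lambda>t. (fst g, 0) + (snd g *v fst (\<gamma> t), snd g ** snd (\<gamma> t))) has_vector_derivative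
      0 + (snd g *v fst u, snd g ** snd u)) F"
    using assms
    by (rule has_vector_derivative_add[OF has_vector_derivative_const
          bounded_linear.has_vector_derivative])
  then show ?thesis
    by (simp add: se3_mult_def)
qed

lemma se3_mult_right_has_vector_derivative:
  assumes "(\<gamma> has_vector_derivative u) F"
  shows "((\<lambda>t. \<gamma> t \<odot> h) has_vector_derivative (fst u + snd u *v fst h, snd u ** snd h)) F"
proof -
  have "linear (\<lambda>u::rigid. u \<odot> h)"
    by (intro linearI)
      (simp_all add: se3_mult_def matrix_vector_mult_add_rdistrib matrix_add_rdistrib
        scaleR_right_distrib scaleR_matrix_vector_assoc flip: scalar_matrix_assoc)
  then have "bounded_linear (\<lambda>u::rigid. u \<odot> h)"
    by (simp add: linear_conv_bounded_linear)
  from bounded_linear.has_vector_derivative[OF this assms] show ?thesis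
    by (simp add: se3_mult_def)
qed

text \<open>A curve inside \<open>SE3\<close> lets the derivative within \<open>SE3\<close> be
  restricted to the range of the curve, where the chain rule applies.\<close>

lemma deriv_along_curve:
  fixes F :: "rigid \<Rightarrow> real"
  assumes "(F has_derivative D) (at (\<gamma> 0) within SE3)"
    and "(\<gamma> has_vector_derivative u) (at 0)"
    and "\<And>t. \<gamma> t \<in> SE3"
  shows "deriv (\<lambda>t. F (\<gamma> t)) 0 = D u"
proof -
  have "(F has_derivative D) (at (\<gamma> 0) within range \<gamma>)"
    using assms(1,3) by (auto intro: has_derivative_subset)
  from vector_derivative_diff_chain_within[OF assms(2) this] show ?thesis
    by (intro DERIV_imp_deriv) (simp add: has_real_derivative_iff_has_vector_derivative o_def)
qed

lemma se3_exp_has_vector_derivative_0: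
  "((\<lambda>t. se3_exp (t *\<^sub>R V)) has_vector_derivative (trans_part V, skew (rot_part V))) (at 0)"
  using se3_exp_has_vector_derivative[of V 0] by (simp add: se3_exp_0 se3_one_def)

lemma lie_deriv_eq:
  assumes "(F has_derivative D) (at g within SE3)" "g \<in> SE3"
  shows "lie_deriv V F g = D (snd g *v trans_part V, snd g ** skew (rot_part V))"
  unfolding lie_deriv_def
  using deriv_along_curve[OF _ se3_mult_left_has_vector_derivative[OF
      se3_exp_has_vector_derivative_0]] assms
  by (simp add: se3_exp_0 se3_exp_in)

lemma linear_skew: "linear skew"
proof (rule linearI)
  show "skew (x + y) = skew x + skew y" for x y
    by (simp add: vec_eq_iff forall_3 skew_entries)
  show "skew (c *\<^sub>R x) = c *\<^sub>R skew x" for c x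
    by (simp add: vec_eq_iff forall_3 skew_entries)
qed

lemma se3_grad_nth: "se3_grad F g $ i = lie_deriv (axis i 1) F g"
  by (simp add: se3_grad_def axis_def if_distrib cong: if_cong)

text \<open>The velocity of the exponential curve at \<open>g\<close> is linear in \<open>V\<close>,
  and so is \<open>D\<close>. Expanding \<open>V\<close> in the standard basis then produces the
  components of the gradient.\<close>

lemma lie_deriv_eq_inner_grad:
  assumes "(F has_derivative D) (at g within SE3)" "g \<in> SE3"
  shows "lie_deriv V F g = se3_grad F g \<bullet> V"
proof -
  have "linear (\<lambda>V::twist. (snd g *v trans_part V, snd g ** skew (rot_part V)))"
  proof (rule linearI)
    fix c :: real and V W :: twist
    have *: "rot_part (V + W) = rot_part V + rot_part W" "trans_part (V + W) = trans_part V + trans_part W"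
      "rot_part (c *\<^sub>R V) = c *\<^sub>R rot_part V" "trans_part (c *\<^sub>R V) = c *\<^sub>R trans_part V"
      by (simp_all add: vec_eq_iff)
    show "(snd g *v trans_part (V + W), snd g ** skew (rot_part (V + W))) =
      (snd g *v trans_part V, snd g ** skew (rot_part V)) + (snd g *v trans_part W, snd g ** skew (rot_part W))"
      unfolding * linear_add[OF linear_skew]
      by (simp add: matrix_vector_right_distrib matrix_add_ldistrib)
    show "(snd g *v trans_part (c *\<^sub>R V), snd g ** skew (rot_part (c *\<^sub>R V))) =
      c *\<^sub>R (snd g *v trans_part V, snd g ** skew (rot_part V))"
      unfolding * linear_scale[OF linear_skew]
      by (simp add: matrix_scalar_ac matrix_vector_mult_scaleR flip: scalar_matrix_assoc)
  qed
  then have "linear (\<lambda>V. lie_deriv V F g)"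
    unfolding lie_deriv_eq[OF assms]
    using linear_compose[OF _ has_derivative_linear[OF assms(1)], unfolded o_def] by blast
  note lin = linear_sum[OF this] linear_scale[OF this]
  have "lie_deriv (\<Sum>i\<in>UNIV. V $ i *\<^sub>R axis i 1) F g = (\<Sum>i\<in>UNIV. V $ i * lie_deriv (axis i 1) F g)"
    by (simp add: lin)
  moreover have "(\<Sum>i\<in>UNIV. V $ i *\<^sub>R axis i 1) = V"
    using basis_expansion[of V] by (simp add: scalar_mult_eq_scaleR)
  ultimately show ?thesis
    by (simp add: inner_vec_def se3_grad_nth mult.commute)
qed

section \<open>The adjoint representation\<close>

lemma trans_part_Ad:
  "trans_part (Ad g *v V) = snd g *v trans_part V + cross3 (fst g) (snd g *v rot_part V)"
proof -
  have "cross3 (fst g) (snd g *v rot_part V) = (skew (fst g) ** snd g) *v rot_part V"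
    by (simp add: skew_mult flip: matrix_vector_mul_assoc)
  then show ?thesis
    by (simp add: vec_eq_iff matrix_vector_mult_def Ad_def sum_UNIV_sum)
qed

lemma rot_part_Ad: "rot_part (Ad g *v V) = snd g *v rot_part V"
  by (simp add: vec_eq_iff matrix_vector_mult_def Ad_def sum_UNIV_sum)

lemma SE3D:
  assumes "g \<in> SE3"
  shows "rotation_matrix (snd g)" "rotation_matrix (transpose (snd g))"
    "transpose (snd g) ** snd g = mat 1" "snd g ** transpose (snd g) = mat 1"
  using assms by (auto simp: SE3_def rotation_matrix_def orthogonal_matrix_def
      orthogonal_matrix_transpose)

text \<open>Rotations preserve the cross product, so the transposed rotation factors out;
  antisymmetry absorbs the minus sign of \<open>se3_inv\<close>. In this form it matches the
  translational velocity of the conjugated exponential curve.\<close>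

lemma trans_part_Ad_inv:
  assumes "g \<in> SE3"
  shows "trans_part (Ad (se3_inv g) *v V)
    = transpose (snd g) *v (trans_part V + cross3 (rot_part V) (fst g))"
proof -
  have "cross3 (- (transpose (snd g) *v fst g)) (transpose (snd g) *v rot_part V)
      = transpose (snd g) *v cross3 (rot_part V) (fst g)"
    using cross_rotation_matrix[OF SE3D(2)[OF assms], of "rot_part V" "fst g"]
      cross_skew[of "transpose (snd g) *v rot_part V" "transpose (snd g) *v fst g"]
    by (simp add: cross_minus_left del: transpose_matrix_vector)
  then show ?thesis
    by (simp add: trans_part_Ad se3_inv_def matrix_vector_right_distrib
        del: transpose_matrix_vector)
qed

lemma rot_part_Ad_inv: "rot_part (Ad (se3_inv g) *v V) = transpose (snd g) *v rot_part V"
  by (simp add: rot_part_Ad se3_inv_def)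

lemma twist_eqI: "trans_part V = trans_part W \<Longrightarrow> rot_part V = rot_part W \<Longrightarrow> V = W"
  by (simp add: vec_eq_iff split_sum_all)

text \<open>By the block formulas, applying \<open>Ad g\<close> and then
  \<open>Ad (se3_inv g)\<close> leaves two cross products of \<open>fst g\<close> with the rotated
  rotational part, in opposite orders; they cancel.\<close>

lemma matrix_inv_Ad:
  assumes "g \<in> SE3"
  shows "matrix_inv (Ad g) = Ad (se3_inv g)"
proof (rule matrix_inv_eqI)
  have "Ad (se3_inv g) *v (Ad g *v V) = V" for V
  proof (rule twist_eqI)
    have "cross3 (fst g) (snd g *v rot_part V) + cross3 (snd g *v rot_part V) (fst g) = 0"
      by (metis cross_skew add.right_inverse)
    then show "trans_part (Ad (se3_inv g) *v (Ad g *v V)) = trans_part V"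
      unfolding trans_part_Ad_inv[OF assms] trans_part_Ad rot_part_Ad
      by (simp add: add.assoc matrix_vector_mul_assoc SE3D(3)[OF assms]
          del: transpose_matrix_vector)
    show "rot_part (Ad (se3_inv g) *v (Ad g *v V)) = rot_part V"
      unfolding rot_part_Ad_inv rot_part_Ad
      by (simp add: matrix_vector_mul_assoc SE3D(3)[OF assms] del: transpose_matrix_vector)
  qed
  then show "Ad (se3_inv g) ** Ad g = mat 1"
    by (simp add: matrix_eq flip: matrix_vector_mul_assoc)
qed

text \<open>Applied to a vector x, both sides become A (w \<times> x), since a rotation preserves
  the cross product. This turns a conjugated \<open>skew\<close> matrix into the \<open>skew\<close>
  matrix of the rotated vector.\<close>

lemma skew_rotate:
  assumes "rotation_matrix A"
  shows "skew (A *v w) ** A = A ** skew w"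
  using assms
  by (simp add: matrix_eq skew_mult cross_rotation_matrix flip: matrix_vector_mul_assoc)

text \<open>No identity between exponentials is needed here: both curves have the same velocity at 0,
  and the derivative of \<open>F\<close> along them depends on nothing else.\<close>

lemma deriv_conjugated_exp:
  assumes F: "(F has_derivative D) (at g within SE3)" and g: "g \<in> SE3" and h: "h \<in> SE3"
  shows "deriv (\<lambda>t. F (g \<odot> se3_inv h \<odot> se3_exp (t *\<^sub>R V) \<odot> h)) 0
    = lie_deriv (Ad (se3_inv h) *v V) F g"
proof -
  let ?\<gamma> = "\<lambda>t. g \<odot> (se3_inv h \<odot> (se3_exp (t *\<^sub>R V) \<odot> h))"
  have "deriv (\<lambda>t. F (?\<gamma> t)) 0 =
    D (snd g *v (transpose (snd h) *v (trans_part V + skew (rot_part V) *v fst h)),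
       snd g ** (transpose (snd h) ** (skew (rot_part V) ** snd h)))"
  proof (rule deriv_along_curve)
    show "(F has_derivative D) (at (?\<gamma> 0) within SE3)"
      using F h by (simp add: se3_exp_0)
    show "(?\<gamma> has_vector_derivative
      (snd g *v (transpose (snd h) *v (trans_part V + skew (rot_part V) *v fst h)),
       snd g ** (transpose (snd h) ** (skew (rot_part V) ** snd h)))) (at 0)"
      using se3_mult_left_has_vector_derivative[OF se3_mult_left_has_vector_derivative[OF
          se3_mult_right_has_vector_derivative[OF se3_exp_has_vector_derivative_0]],
          of g "se3_inv h" V h]
      by (simp add: se3_inv_def del: transpose_matrix_vector)
    show "?\<gamma> t \<in> SE3" for t
      using g h by (simp add: se3_exp_in)
  qed
  moreover have "transpose (snd h) ** (skew (rot_part V) ** snd h)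
      = skew (rot_part (Ad (se3_inv h) *v V))"
    unfolding rot_part_Ad_inv matrix_mul_assoc skew_rotate[OF SE3D(2)[OF h], symmetric]
    by (simp add: SE3D(3)[OF h] flip: matrix_mul_assoc)
  ultimately show ?thesis
    by (simp add: lie_deriv_eq[OF F g] trans_part_Ad_inv[OF h] skew_mult se3_mult_assoc)
qed

section \<open>Transformation of the score\<close>

theorem proposition1:
  fixes dg :: "rigid measure"
    and P :: "rigid \<Rightarrow> cloud \<Rightarrow> cloud \<Rightarrow> real"
  assumes haar: "bi_invariant_haar dg"
    and density: "\<And>Os Oe. Os \<in> point_clouds \<Longrightarrow> Oe \<in> point_clouds \<Longrightarrow>
          prob_density dg (\<lambda>g. P g Os Oe)"
    and pos: "\<And>g Os Oe. g \<in> SE3 \<Longrightarrow> Os \<in> point_clouds \<Longrightarrow> Oe \<in> point_clouds \<Longrightarrow>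
          0 < P g Os Oe"
    and diff: "\<And>Os Oe. Os \<in> point_clouds \<Longrightarrow> Oe \<in> point_clouds \<Longrightarrow>
          (\<lambda>g. P g Os Oe) differentiable_on SE3"
    and equivariant: "bi_equivariant P"
  shows "\<forall>\<Delta>g\<in>SE3. \<forall>g\<in>SE3. \<forall>Os\<in>point_clouds. \<forall>Oe\<in>point_clouds.
           score P (\<Delta>g \<odot> g) (\<Delta>g \<cdot> Os) Oe = score P g Os Oe \<and>
           score P (g \<odot> se3_inv \<Delta>g) Os (\<Delta>g \<cdot> Oe) =
             transpose (matrix_inv (Ad \<Delta>g)) *v score P g Os Oe"
proof (intro ballI conjI)
  fix h g Os Oe
  assume h: "h \<in> SE3" and g: "g \<in> SE3" and Os: "Os \<in> point_clouds" and Oe: "Oe \<in> point_clouds"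
  let ?F = "\<lambda>x. ln (P x Os Oe)"
  have left: "P (h \<odot> x) (h \<cdot> Os) Oe = P x Os Oe" if "x \<in> SE3" for x
    using equivariant h that Os Oe by (simp add: bi_equivariant_def)
  have right: "P x Os (h \<cdot> Oe) = P (x \<odot> h) Os Oe" if "x \<in> SE3" for x
  proof -
    have "P (x \<odot> h) Os Oe = P (x \<odot> h \<odot> se3_inv h) Os (h \<cdot> Oe)"
      using equivariant[unfolded bi_equivariant_def] h se3_mult_in[OF that h] Os Oe by blast
    then show ?thesis
      using h by (simp add: se3_mult_assoc)
  qed
  show "score P (h \<odot> g) (h \<cdot> Os) Oe = score P g Os Oe"
    \<comment> \<open>By associativity and \<open>left\<close>, both Lie derivatives differentiate
      the same real function of the curve parameter.\<close>
    using g by (simp add: score_def se3_grad_def lie_deriv_def se3_mult_assoc left se3_exp_in)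
  obtain D0 where "((\<lambda>x. P x Os Oe) has_derivative D0) (at g within SE3)"
    using diff[OF Os Oe] g by (auto simp: differentiable_on_def differentiable_def)
  \<comment> \<open>Positivity of the density at \<open>g\<close> lets the logarithm inherit
    differentiability within \<open>SE3\<close>.\<close>
  then obtain D where D: "(?F has_derivative D) (at g within SE3)"
    using has_derivative_ln[where g = "\<lambda>x. P x Os Oe" and x = g] pos[OF g Os Oe] by blast
  have "score P (g \<odot> se3_inv h) Os (h \<cdot> Oe) $ i
      = (transpose (Ad (se3_inv h)) *v score P g Os Oe) $ i" for i
  proof -
    have "score P (g \<odot> se3_inv h) Os (h \<cdot> Oe) $ i
        = deriv (\<lambda>t. ?F (g \<odot> se3_inv h \<odot> se3_exp (t *\<^sub>R axis i 1) \<odot> h)) 0"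
      using g h by (simp add: score_def se3_grad_nth lie_deriv_def right se3_exp_in)
    also have "\<dots> = score P g Os Oe \<bullet> (Ad (se3_inv h) *v axis i 1)"
      unfolding score_def
      by (simp add: deriv_conjugated_exp[OF D g h] lie_deriv_eq_inner_grad[OF D g])
    \<comment> \<open>Moving the matrix across the inner product transposes it, and pairing with the
      basis vector reads off component \<open>i\<close>.\<close>
    also have "\<dots> = (transpose (Ad (se3_inv h)) *v score P g Os Oe) $ i"
      by (simp add: inner_vec_def matrix_vector_mult_def transpose_def axis_def if_distrib
          mult.commute cong: if_cong del: transpose_matrix_vector)
    finally show ?thesis .
  qed
  then show "score P (g \<odot> se3_inv h) Os (h \<cdot> Oe)
      = transpose (matrix_inv (Ad h)) *v score P g Os Oe"
    by (simp add: vec_eq_iff matrix_inv_Ad[OF h] del: transpose_matrix_vector)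
qed

end
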